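(* The additive group of every field is natural, without a cardinality restriction. More generally, the additive group of every vector space over $\mathbb Q$ or over a prime field $\mathbb F_p$ ($p$ prime) is natural.
   Context: A metric $d$ on a group $G$ is right-invariant if $d(xg,yg)=d(x,y)$ for all $x,y,g\in G$. An isometry is a surjective distance-preserving map. A right-invariant metric $d$ on $G$ is naturalizing if every group law on the underlying set of $G$ (possibly nonabelian, possibly with a different identity element) all of whose right translations are isometries of $d$ is abstractly isomorphic to $G$. A group is natural if it admits a naturalizing right-invariant metric. Groups are abstract (no topology is prescribed). *)

theory Defs
  imports
    "HOL-Analysis.Abstract_Metric_Spaces"
    "HOL-Algebra.Module"
    "HOL-Algebra.Algebraic_Closure_Type"
    "HOL-Number_Theory.Residues"
begin

definition isometry_of :: "'a set \<Rightarrow> ('a \<Rightarrow> 'a \<Rightarrow> real) \<Rightarrow> ('a \<Rightarrow> 'a) \<Rightarrow> bool" where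
  "isometry_of M d f \<longleftrightarrow>
     f ` M = M \<and> (\<forall>x\<in>M. \<forall>y\<in>M. d (f x) (f y) = d x y)"

definition right_invariant_metric ::
    "('a, 'm) monoid_scheme \<Rightarrow> ('a \<Rightarrow> 'a \<Rightarrow> real) \<Rightarrow> bool" where
  "right_invariant_metric G d \<longleftrightarrow>
     Metric_space (carrier G) d \<and>
     (\<forall>x\<in>carrier G. \<forall>y\<in>carrier G. \<forall>g\<in>carrier G.
        d (x \<otimes>\<^bsub>G\<^esub> g) (y \<otimes>\<^bsub>G\<^esub> g) = d x y)"

text \<open>
  A competing group law on the underlying set of \<open>G\<close> is a group \<open>H\<close> with the same carrier;
  its operation and its identity element are otherwise unrelated to those of \<open>G\<close>.
\<close>

definition naturalizing_metric ::
    "('a, 'm) monoid_scheme \<Rightarrow> ('a \<Rightarrow> 'a \<Rightarrow> real) \<Rightarrow> bool" where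
  "naturalizing_metric G d \<longleftrightarrow>
     right_invariant_metric G d \<and>
     (\<forall>H :: 'a monoid.
        group H \<longrightarrow> carrier H = carrier G \<longrightarrow>
        (\<forall>g\<in>carrier H. isometry_of (carrier G) d (\<lambda>x. x \<otimes>\<^bsub>H\<^esub> g)) \<longrightarrow>
        H \<cong> G)"

definition natural_group :: "('a, 'm) monoid_scheme \<Rightarrow> bool" where
  "natural_group G \<longleftrightarrow> group G \<and> (\<exists>d. naturalizing_metric G d)"

text \<open>
  The prime fields as rings with explicit carrier. A vector space over one of them is a
  library module over it, and its additive group is the \<open>add_monoid\<close> of that module.
\<close>

abbreviation rat_field :: "rat ring" where
  "rat_field \<equiv> ring_of_type_algebra"

abbreviation prime_field :: "nat \<Rightarrow> int ring" where
  "prime_field p \<equiv> residue_ring (int p)"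

end

theory Submission
  imports Defs "HOL-Algebra.Generated_Fields"
begin

text \<open>
  Let \<open>V\<close> be a vector space over a countable field with basis \<open>B\<close>.
  Countably many values are available for an invariant metric with values in \<open>[1,
  2]\<close> off the diagonal, so the distance of \<open>x\<close> and \<open>y\<close> may
  encode any countable datum of \<open>\<plusminus>(x - y)\<close>. It encodes the size of the
  support together with the products of pairs of coordinates, each tagged by a rigid colouring
  of the pairs of basis vectors. Such a colouring exists for every set: an infinite
  \<open>B\<close> is split into two copies of itself and the edges between the two copies
  record a well-order. Isometries preserve the Hamming distance, hence act on the coordinates
  separately, and the tags leave only \<open>x \<mapsto> \<plusminus>x + v\<close>. In
  characteristic other than 2 the map \<open>x \<mapsto> v - x\<close> has the fixed point
  \<open>v / 2\<close>, so it is not a nontrivial right translation of a group; the right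
  translations of a competing group law are therefore exactly the translations of
  \<open>V\<close>. A field is a vector space over its prime field, which is countable.
\<close>

section \<open>Rigid edge colourings\<close>

text \<open>Colours are natural numbers, so that they can enter a countable code even when
  \<open>B\<close> is uncountable. Diagonal colours are kept apart from the others so that the tag
  of a product of two different coordinates can be recognised.\<close>

locale rigid_colouring =
  fixes B :: "'c set" and e :: "'c \<Rightarrow> 'c \<Rightarrow> nat"
  assumes e_sym: "e a b = e b a"
    and e_diag: "\<lbrakk>a \<in> B; b \<in> B; b' \<in> B; b \<noteq> b'\<rbrakk> \<Longrightarrow> e a a \<noteq> e b b'"
    and e_rigid: "\<lbrakk>bij_betw \<pi> B B; \<And>a b. \<lbrakk>a \<in> B; b \<in> B\<rbrakk> \<Longrightarrow> e (\<pi> a) (\<pi> b) = e a b; a \<in> B\<rbrakk> \<Longrightarrow> \<pi> a = a"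

text \<open>If \<open>B\<close> is uncountable, countably many colours cannot mark the vertices one
  by one, so the rigidity has to come from the edges. A colour-preserving permutation acts on the
  indices of each of the two copies, and the edges between the copies force both actions to respect
  a well-order.\<close>

lemma ex_rigid_colouring:
  includes cardinal_syntax
  fixes B :: "'a set"
  shows "\<exists>e. rigid_colouring B e"
proof (cases "countable B")
  case True
  \<comment> \<open>Vertices are marked injectively; \<open>Suc\<close> keeps the marks away from
    the off-diagonal colour 0.\<close>
  define e where "e = (\<lambda>a b. if a = b then Suc (to_nat_on B a) else 0)"
  show ?thesis
  proof (intro exI[of _ e] rigid_colouring.intro)
    fix \<pi> a assume \<pi>: "bij_betw \<pi> B B" "\<And>a b. \<lbrakk>a \<in> B; b \<in> B\<rbrakk> \<Longrightarrow> e (\<pi> a) (\<pi> b) = e a b" "a \<in> B"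
    have "to_nat_on B (\<pi> a) = to_nat_on B a"
      using \<pi>(2)[OF \<pi>(3,3)] by (simp add: e_def)
    moreover have "\<pi> a \<in> B" using \<pi> by (meson bij_betwE)
    ultimately show "\<pi> a = a" using True \<pi>(3) by simp
  qed (auto simp: e_def)
next
  case False
  hence "infinite B" using countable_finite by blast
  hence "|B <+> B| =o |B|" by (intro card_of_Plus_infinite1) (simp_all add: card_of_mono1)
  hence "|B \<times> (UNIV::bool set)| =o |B|"
    using card_of_Plus_Times_bool ordIso_symmetric ordIso_transitive by blast
  then obtain h where h: "bij_betw h (B \<times> (UNIV::bool set)) B"
    using card_of_ordIso by blast
  obtain r :: "'a rel" where r: "well_order_on UNIV r"
    using well_order_on by blast
  have tot: "(i, j) \<in> r \<or> (j, i) \<in> r" for i j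
    using r by (cases "i = j") (auto simp: well_order_on_def linear_order_on_def
        partial_order_on_def preorder_on_def refl_on_def total_on_def)
  have anti: "i = j" if "(i, j) \<in> r" "(j, i) \<in> r" for i j
    using r that by (auto simp: well_order_on_def linear_order_on_def
        partial_order_on_def antisym_def)
  have wf: "wf (r - Id)" using r by (simp add: well_order_on_def)
  define k where "k = inv_into (B \<times> (UNIV::bool set)) h"
  have kh: "k (h (i, s)) = (i, s)" if "i \<in> B" for i s
    using h that by (simp add: k_def bij_betw_inv_into_left)
  have hB: "h (i, s) \<in> B" if "i \<in> B" for i s
    using h that by (auto dest: bij_betwE)
  have hcase: "\<exists>i\<in>B. \<exists>s. x = h (i, s)" if "x \<in> B" for x
    using h that by (force simp: bij_betw_def)
  \<comment> \<open>Five colours suffice: 0 and 1 mark the copies, 2 fills the edges inside a copy,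
    and 3 or 4 tells whether the index in the copy \<open>False\<close> is at most the index in the
    copy \<open>True\<close>. The inner conditional puts the \<open>False\<close> index first, which
    makes \<open>e\<close> symmetric.\<close>
  define e where "e = (\<lambda>x y. if x = y then (if snd (k x) then 1 else 0)
      else if snd (k x) = snd (k y) then 2
      else if (if snd (k x) then (fst (k y), fst (k x)) else (fst (k x), fst (k y))) \<in> r then 3
      else (4::nat))"
  have diag: "e (h (i, s)) (h (i, s)) = (if s then 1 else 0)" if "i \<in> B" for i s
    using that by (simp add: e_def kh)
  have ord: "e (h (i, False)) (h (j, True)) = (if (i, j) \<in> r then 3 else 4)" if "i \<in> B" "j \<in> B" for i j
    using that kh[of i False] kh[of j True] by (auto simp: e_def)
  show ?thesis
  proof (intro exI[of _ e] rigid_colouring.intro)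
    fix a b :: 'a show "e a b = e b a" by (auto simp: e_def)
  next
    fix a b b' :: 'a assume "b \<noteq> b'" thus "e a a \<noteq> e b b'" by (auto simp: e_def)
  next
    fix \<pi> a assume \<pi>: "bij_betw \<pi> B B"
      and pres: "\<And>a b. \<lbrakk>a \<in> B; b \<in> B\<rbrakk> \<Longrightarrow> e (\<pi> a) (\<pi> b) = e a b" and "a \<in> B"
    have \<pi>B: "\<pi> x \<in> B" if "x \<in> B" for x using \<pi> that by (auto dest: bij_betwE)
    have inj: "x = y" if "\<pi> x = \<pi> y" "x \<in> B" "y \<in> B" for x y
      using \<pi> that by (auto simp: bij_betw_def inj_on_def)
    \<comment> \<open>The diagonal colours force \<pi> to map each copy into itself;
      \<open>lab'\<close> adds that it maps each copy onto itself.\<close>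
    have lab: "\<exists>j\<in>B. \<pi> (h (i, s)) = h (j, s)" if i: "i \<in> B" for i s
    proof -
      obtain j t where j: "j \<in> B" "\<pi> (h (i, s)) = h (j, t)"
        using hcase[OF \<pi>B[OF hB[OF i, of s]]] by blast
      have "e (h (j, t)) (h (j, t)) = e (h (i, s)) (h (i, s))"
        using pres[OF hB[OF i, of s] hB[OF i, of s]] unfolding j(2) .
      hence "t = s" unfolding diag[OF i] diag[OF j(1)] by (cases s; cases t) simp_all
      thus ?thesis using j by blast
    qed
    have lab': "\<exists>j\<in>B. \<pi> (h (j, s)) = h (i, s)" if i: "i \<in> B" for i s
    proof -
      have "h (i, s) \<in> \<pi> ` B" using \<pi> hB[OF i] by (simp add: bij_betw_def)
      then obtain x where x: "x \<in> B" "\<pi> x = h (i, s)" by force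
      obtain j t where jt: "j \<in> B" "x = h (j, t)" using hcase[OF x(1)] by blast
      obtain j' where j': "j' \<in> B" "\<pi> x = h (j', t)" using lab[OF jt(1)] jt(2) by blast
      have "k (h (j', t)) = k (h (i, s))" unfolding j'(2)[symmetric] x(2) ..
      hence "t = s" unfolding kh[OF j'(1)] kh[OF i] by simp
      hence "\<pi> (h (j, s)) = h (i, s)" using x(2) unfolding jt(2) by blast
      thus ?thesis using jt(1) by blast
    qed
    have heq: "i = j" if "h (i, s) = h (j, s)" "i \<in> B" "j \<in> B" for i j s
      using arg_cong[OF that(1), of k] unfolding kh[OF that(2)] kh[OF that(3)] by blast
    have main: "i \<in> B \<longrightarrow> \<pi> (h (i, False)) = h (i, False) \<and> \<pi> (h (i, True)) = h (i, True)" for i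
      using wf
    proof (induction i rule: wf_induct_rule)
      case (less i)
      show ?case
      proof
        assume i: "i \<in> B"
        have IH: "\<pi> (h (m, s)) = h (m, s)" if "m \<in> B" "(m, i) \<in> r" "m \<noteq> i" for m s
          using less.IH[of m] that by (cases s) auto
        \<comment> \<open>Indices strictly below \<open>i\<close> are fixed by the induction
          hypothesis, so only indices from \<open>i\<close> upwards can be sent to an index from
          \<open>i\<close> upwards. Injectivity gives the converse in \<open>ge'\<close>.\<close>
        have ge: "(i, m) \<in> r" if "m \<in> B" "n \<in> B" "\<pi> (h (m, s)) = h (n, s)" "(i, n) \<in> r" for m n s
        proof (rule ccontr)
          assume c: "(i, m) \<notin> r"
          hence "\<pi> (h (m, s)) = h (m, s)" using tot[of i m] that(1) by (intro IH) auto
          hence "m = n" using heq[OF _ that(1,2)] that(3) by metis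
          thus False using c that(4) by blast
        qed
        have ge': "(i, n) \<in> r" if n: "n \<in> B" "\<pi> (h (i, s)) = h (n, s)" for n s
        proof (rule ccontr)
          assume c: "(i, n) \<notin> r"
          hence "(n, i) \<in> r" "n \<noteq> i" using tot[of i n] by auto
          hence "\<pi> (h (n, s)) = \<pi> (h (i, s))" using IH n by simp
          hence "n = i" using inj hB heq n(1) i by blast
          thus False using \<open>n \<noteq> i\<close> by simp
        qed
        obtain j' where j': "j' \<in> B" "\<pi> (h (i, True)) = h (j', True)" using lab[OF i] by blast
        obtain m where m: "m \<in> B" "\<pi> (h (m, False)) = h (i, False)" using lab'[OF i] by blast
        have ij: "(i, j') \<in> r" using ge'[OF j'] .
        \<comment> \<open>The edge from \<open>h (m, False)\<close> to \<open>h (i, True)\<close> is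
          mapped to the edge from \<open>h (i, False)\<close> to \<open>h (j', True)\<close>, which
          has colour 3 by \<open>ij\<close>.\<close>
        have "(m, i) \<in> r"
          using pres[OF hB[OF m(1), of False] hB[OF i, of True]] m j' ij
          by (simp add: ord i split: if_splits)
        moreover have "(i, m) \<in> r" using ge[OF m(1) i m(2)] tot by blast
        ultimately have F: "\<pi> (h (i, False)) = h (i, False)" using m(2) anti by metis
        obtain n where n: "n \<in> B" "\<pi> (h (n, False)) = h (j', False)" using lab'[OF j'(1)] by blast
        \<comment> \<open>Here the image is the edge from \<open>h (j', False)\<close> to
          \<open>h (j', True)\<close>, of colour 3 by reflexivity of \<open>r\<close>.\<close>
        have "(n, i) \<in> r"
          using pres[OF hB[OF n(1), of False] hB[OF i, of True]] n j' tot[of j' j']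
          by (simp add: ord i split: if_splits)
        moreover have "(i, n) \<in> r" using ge[OF n(1) j'(1) n(2) ij] .
        ultimately have "n = i" by (rule anti)
        hence "j' = i" using F n(2) heq[OF _ i j'(1)] by metis
        thus "\<pi> (h (i, False)) = h (i, False) \<and> \<pi> (h (i, True)) = h (i, True)"
          using F j'(2) by simp
      qed
    qed
    obtain i s where "i \<in> B" "a = h (i, s)" using hcase[OF \<open>a \<in> B\<close>] by blast
    thus "\<pi> a = a" using main[of i] by (cases s) auto
  qed
qed

section \<open>Countability of prime fields\<close>

datatype field_term = One | Neg field_term | Inv field_term
  | Plus field_term field_term | Times field_term field_term

instance field_term :: countable by countable_datatype

primrec eval_term :: "('a, 'm) ring_scheme \<Rightarrow> field_term \<Rightarrow> 'a" where
  "eval_term K One = \<one>\<^bsub>K\<^esub>"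
| "eval_term K (Neg t) = \<ominus>\<^bsub>K\<^esub> eval_term K t"
| "eval_term K (Inv t) = inv\<^bsub>K\<^esub> eval_term K t"
| "eval_term K (Plus s t) = eval_term K s \<oplus>\<^bsub>K\<^esub> eval_term K t"
| "eval_term K (Times s t) = eval_term K s \<otimes>\<^bsub>K\<^esub> eval_term K t"

text \<open>Without generators every element is the value of a closed term, and there are only
  countably many of these.\<close>

lemma countable_generate_field_empty: "countable (generate_field K {})"
proof -
  have "\<exists>t. x = eval_term K t" if "x \<in> generate_field K {}" for x
    using that
  proof induction
    case one show ?case by (rule exI[of _ One]) simp
  next
    case (a_inv h) then obtain t where "h = eval_term K t" by blast
    thus ?case by (intro exI[of _ "Neg t"]) simp
  next
    case (m_inv h) then obtain t where "h = eval_term K t" by blast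
    thus ?case by (intro exI[of _ "Inv t"]) simp
  next
    case (eng_add h1 h2) then obtain s t where "h1 = eval_term K s" "h2 = eval_term K t" by blast
    thus ?case by (intro exI[of _ "Plus s t"]) simp
  next
    case (eng_mult h1 h2) then obtain s t where "h1 = eval_term K s" "h2 = eval_term K t" by blast
    thus ?case by (intro exI[of _ "Times s t"]) simp
  qed simp
  hence "generate_field K {} \<subseteq> range (eval_term K)" by blast
  thus ?thesis by (rule countable_subset) simp
qed

section \<open>Bases of vector spaces\<close>

text \<open>A basis presented by its coordinate functions, so that the arguments about isometries
  never handle sums over the basis.\<close>

locale coordinates = module R M + R?: field R for R and M (structure) +
  fixes B :: "'c set" and c :: "'c \<Rightarrow> 'c \<Rightarrow> 'a"
  assumes basis_closed: "B \<subseteq> carrier M"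
    and coord_closed [simp, intro]: "x \<in> carrier M \<Longrightarrow> c x b \<in> carrier R"
    and finite_support: "x \<in> carrier M \<Longrightarrow> finite {b. c x b \<noteq> \<zero>\<^bsub>R\<^esub>}"
    and coord_outside: "x \<in> carrier M \<Longrightarrow> b \<notin> B \<Longrightarrow> c x b = \<zero>\<^bsub>R\<^esub>"
    and coord_minus: "x \<in> carrier M \<Longrightarrow> y \<in> carrier M \<Longrightarrow> c (x \<ominus> y) b = c x b \<ominus>\<^bsub>R\<^esub> c y b"
    and coord_inj: "x \<in> carrier M \<Longrightarrow> y \<in> carrier M \<Longrightarrow> (\<And>b. b \<in> B \<Longrightarrow> c x b = c y b) \<Longrightarrow> x = y"
    and coord_smult_basis: "r \<in> carrier R \<Longrightarrow> b \<in> B \<Longrightarrow> c (r \<odot> b) b' = (if b = b' then r else \<zero>\<^bsub>R\<^esub>)"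

locale vector_module = module R M + R?: field R for R and M (structure)
begin

abbreviation lincomb :: "('c \<Rightarrow> 'a) \<Rightarrow> 'c set \<Rightarrow> 'c" where
  "lincomb a A \<equiv> (\<Oplus>b\<in>A. a b \<odot> b)"

definition indep :: "'c set \<Rightarrow> bool" where
  "indep B \<longleftrightarrow> B \<subseteq> carrier M \<and>
     (\<forall>A a. finite A \<longrightarrow> A \<subseteq> B \<longrightarrow> a \<in> A \<rightarrow> carrier R \<longrightarrow> lincomb a A = \<zero> \<longrightarrow> (\<forall>b\<in>A. a b = \<zero>\<^bsub>R\<^esub>))"

text \<open>Zorn's lemma applies because a linear relation involves finitely many vectors, which lie
  in a single member of a nonempty chain.\<close>

lemma ex_maximal_indep: "\<exists>B. indep B \<and> (\<forall>x\<in>carrier M. indep (insert x B) \<longrightarrow> x \<in> B)"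
proof -
  have "\<exists>m\<in>Collect indep. \<forall>S\<in>Collect indep. m \<subseteq> S \<longrightarrow> S = m"
  proof (rule subset_Zorn')
    fix C assume C: "subset.chain (Collect indep) C"
    show "\<Union>C \<in> Collect indep"
    proof (cases "C = {}")
      case True thus ?thesis by (auto simp: indep_def)
    next
      case False
      have "indep (\<Union>C)" unfolding indep_def
      proof (intro conjI allI impI)
        have "C \<subseteq> Collect indep" using C by (simp add: subset.chain_def)
        thus "\<Union>C \<subseteq> carrier M" unfolding indep_def by blast
      next
        fix A a assume A: "finite A" "A \<subseteq> \<Union>C" "a \<in> A \<rightarrow> carrier R" "lincomb a A = \<zero>"
        obtain B where "B \<in> C" "A \<subseteq> B"
          using finite_subset_Union_chain[OF A(1,2) False C] by blast
        moreover have "indep B" using C \<open>B \<in> C\<close> by (auto simp: subset.chain_def)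
        ultimately show "\<forall>b\<in>A. a b = \<zero>\<^bsub>R\<^esub>" using A unfolding indep_def by blast
      qed
      thus ?thesis by simp
    qed
  qed
  then obtain B where B: "indep B" "\<And>S. indep S \<Longrightarrow> B \<subseteq> S \<Longrightarrow> S = B" by auto
  show ?thesis using B(1) B(2)[OF _ subset_insertI] by blast
qed

text \<open>The coefficients are extended by zero outside \<open>B\<close>, so that uniqueness of a
  representation is plain equality of functions.\<close>

definition represents :: "'c set \<Rightarrow> ('c \<Rightarrow> 'a) \<Rightarrow> 'c \<Rightarrow> bool" where
  "represents B a x \<longleftrightarrow> (\<forall>b. a b \<in> carrier R) \<and> (\<forall>b. b \<notin> B \<longrightarrow> a b = \<zero>\<^bsub>R\<^esub>) \<and>
     finite {b. a b \<noteq> \<zero>\<^bsub>R\<^esub>} \<and> x = lincomb a {b. a b \<noteq> \<zero>\<^bsub>R\<^esub>}"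

text \<open>The sum may run over any finite part of \<open>B\<close> containing the support; this
  lets two representations be subtracted on a common index set.\<close>

lemma represents_iff:
  assumes "B \<subseteq> carrier M" "A \<subseteq> B" "finite A" "\<And>b. a b \<in> carrier R" "\<And>b. b \<notin> A \<Longrightarrow> a b = \<zero>\<^bsub>R\<^esub>"
  shows "represents B a x \<longleftrightarrow> x = lincomb a A"
proof -
  have sub: "{b. a b \<noteq> \<zero>\<^bsub>R\<^esub>} \<subseteq> A" using assms(5) by blast
  have "lincomb a {b. a b \<noteq> \<zero>\<^bsub>R\<^esub>} = lincomb a A"
    using assms sub by (intro M.add.finprod_mono_neutral_cong_left) auto
  moreover have "finite {b. a b \<noteq> \<zero>\<^bsub>R\<^esub>}" using sub assms(3) by (rule finite_subset)
  ultimately show ?thesis using assms unfolding represents_def by auto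
qed

lemma lincomb_minus:
  assumes "finite A" "A \<subseteq> carrier M" "\<And>b. a b \<in> carrier R" "\<And>b. a' b \<in> carrier R"
  shows "lincomb (\<lambda>b. a b \<ominus>\<^bsub>R\<^esub> a' b) A = lincomb a A \<ominus> lincomb a' A"
  using assms
proof (induction A rule: finite_induct)
  case empty
  show ?case using M.add.inv_one by (simp add: M.minus_eq a_inv_def)
next
  case (insert x F)
  have cl: "lincomb a F \<in> carrier M" "lincomb a' F \<in> carrier M" "a x \<odot> x \<in> carrier M" "a' x \<odot> x \<in> carrier M"
    using insert.prems by (auto intro!: M.finsum_closed)
  have sm: "(a x \<ominus>\<^bsub>R\<^esub> a' x) \<odot> x = a x \<odot> x \<ominus> a' x \<odot> x"
    using insert.prems by (simp add: R.minus_eq M.minus_eq smult_l_distr smult_l_minus)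
  have "lincomb (\<lambda>b. a b \<ominus>\<^bsub>R\<^esub> a' b) (insert x F) = (a x \<odot> x \<ominus> a' x \<odot> x) \<oplus> (lincomb a F \<ominus> lincomb a' F)"
    using insert by (subst M.finsum_insert) (auto simp: sm)
  also have "\<dots> = (a x \<odot> x \<oplus> lincomb a F) \<ominus> (a' x \<odot> x \<oplus> lincomb a' F)"
    using cl by (simp add: M.minus_eq M.minus_add M.a_ac)
  also have "\<dots> = lincomb a (insert x F) \<ominus> lincomb a' (insert x F)"
    using insert by (subst (1 2) M.finsum_insert) auto
  finally show ?case .
qed

lemma represents_minus:
  assumes "B \<subseteq> carrier M" "represents B a x" "represents B a' x'"
  shows "represents B (\<lambda>b. a b \<ominus>\<^bsub>R\<^esub> a' b) (x \<ominus> x')"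
proof -
  define A where "A = {b. a b \<noteq> \<zero>\<^bsub>R\<^esub>} \<union> {b. a' b \<noteq> \<zero>\<^bsub>R\<^esub>}"
  have A: "A \<subseteq> B" "finite A" "\<And>b. b \<notin> A \<Longrightarrow> a b = \<zero>\<^bsub>R\<^esub>" "\<And>b. b \<notin> A \<Longrightarrow> a' b = \<zero>\<^bsub>R\<^esub>"
    using assms(2,3) unfolding represents_def A_def by auto
  have cl: "a b \<in> carrier R" "a' b \<in> carrier R" for b using assms(2,3) unfolding represents_def by auto
  have "x = lincomb a A" "x' = lincomb a' A"
    using assms represents_iff[of B A a x, OF assms(1) A(1,2) cl(1) A(3)] represents_iff[of B A a' x', OF assms(1) A(1,2) cl(2) A(4)]
    by blast+
  moreover have "represents B (\<lambda>b. a b \<ominus>\<^bsub>R\<^esub> a' b) (x \<ominus> x') \<longleftrightarrow>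
      x \<ominus> x' = lincomb (\<lambda>b. a b \<ominus>\<^bsub>R\<^esub> a' b) A"
    using assms(1) A cl by (intro represents_iff) (auto simp: R.minus_eq)
  ultimately show ?thesis using lincomb_minus[of A a a'] A cl assms(1) by auto
qed

lemma represents_zero:
  assumes "indep B" "represents B a \<zero>" shows "a b = \<zero>\<^bsub>R\<^esub>"
proof (rule ccontr)
  assume "a b \<noteq> \<zero>\<^bsub>R\<^esub>"
  moreover have "finite {b. a b \<noteq> \<zero>\<^bsub>R\<^esub>}" "{b. a b \<noteq> \<zero>\<^bsub>R\<^esub>} \<subseteq> B"
    "a \<in> {b. a b \<noteq> \<zero>\<^bsub>R\<^esub>} \<rightarrow> carrier R" "lincomb a {b. a b \<noteq> \<zero>\<^bsub>R\<^esub>} = \<zero>"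
    using assms(2) unfolding represents_def by auto
  ultimately show False using assms(1) unfolding indep_def by blast
qed

lemma represents_unique:
  assumes "indep B" "represents B a x" "represents B a' x" "x \<in> carrier M" shows "a = a'"
proof
  fix b
  have "represents B (\<lambda>b. a b \<ominus>\<^bsub>R\<^esub> a' b) (x \<ominus> x)"
    using assms by (intro represents_minus) (auto simp: indep_def)
  hence "a b \<ominus>\<^bsub>R\<^esub> a' b = \<zero>\<^bsub>R\<^esub>"
    using represents_zero[OF assms(1), of "\<lambda>b. a b \<ominus>\<^bsub>R\<^esub> a' b"] assms(4) by (simp add: M.minus_eq M.r_neg)
  thus "a b = a' b" using assms(2,3) unfolding represents_def by (simp add: R.r_right_minus_eq)
qed

lemma represents_smult:
  assumes "B \<subseteq> carrier M" "b \<in> B" "r \<in> carrier R"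
  shows "represents B (\<lambda>b'. if b = b' then r else \<zero>\<^bsub>R\<^esub>) (r \<odot> b)"
  using assms by (subst represents_iff[where A = "{b}"]) (auto simp: M.finsum_insert)

text \<open>For \<open>x\<close> outside \<open>B\<close>, maximality yields a nontrivial relation
  on \<open>insert x B\<close>. Its coefficient at \<open>x\<close> is nonzero, since otherwise
  \<open>B\<close> would be dependent, and so the relation can be solved for
  \<open>x\<close>.\<close>

lemma maximal_indep_represents:
  assumes B: "indep B" and max: "\<And>x. x \<in> carrier M \<Longrightarrow> indep (insert x B) \<Longrightarrow> x \<in> B"
    and x: "x \<in> carrier M"
  shows "\<exists>a. represents B a x"
proof (cases "x \<in> B")
  case True thus ?thesis using represents_smult[of B x "\<one>\<^bsub>R\<^esub>"] B x by (auto simp: indep_def)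
next
  case False
  hence "\<not> indep (insert x B)" using max x by blast
  then obtain A a b where A: "finite A" "A \<subseteq> insert x B" "a \<in> A \<rightarrow> carrier R" "lincomb a A = \<zero>"
      "b \<in> A" "a b \<noteq> \<zero>\<^bsub>R\<^esub>"
    using B x unfolding indep_def by auto
  have BM: "B \<subseteq> carrier M" using B by (simp add: indep_def)
  have indepB: "\<forall>b\<in>A'. a' b = \<zero>\<^bsub>R\<^esub>"
    if "finite A'" "A' \<subseteq> B" "a' \<in> A' \<rightarrow> carrier R" "lincomb a' A' = \<zero>" for A' a'
    using B that unfolding indep_def by blast
  have xA: "x \<in> A" using indepB[of A a] A by blast
  define A' where "A' = A - {x}"
  have A': "finite A'" "A' \<subseteq> B" "a \<in> A' \<rightarrow> carrier R" "A = insert x A'" "x \<notin> A'"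
    using A xA by (auto simp: A'_def)
  have ax: "a x \<in> carrier R" using A(3) xA by auto
  have lcl: "lincomb a A' \<in> carrier M" using A' BM by (intro M.finsum_closed) auto
  have eq: "a x \<odot> x \<oplus> lincomb a A' = \<zero>"
    using A(4) A' ax x BM unfolding A'(4) by (subst (asm) M.finsum_insert) auto
  have ax0: "a x \<noteq> \<zero>\<^bsub>R\<^esub>"
  proof
    assume "a x = \<zero>\<^bsub>R\<^esub>"
    hence "\<forall>b\<in>A'. a b = \<zero>\<^bsub>R\<^esub>" using indepB[of A' a] A' eq x lcl by simp
    thus False using A(5,6) A'(4) \<open>a x = \<zero>\<^bsub>R\<^esub>\<close> by auto
  qed
  define i where "i = inv\<^bsub>R\<^esub> (a x)"
  have i: "i \<in> carrier R" "i \<otimes>\<^bsub>R\<^esub> a x = \<one>\<^bsub>R\<^esub>" using ax ax0 R.field_Units unfolding i_def by auto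
  have "a x \<odot> x = \<ominus> lincomb a A'" using eq ax x lcl by (simp add: M.minus_equality)
  hence "i \<odot> (a x \<odot> x) = (\<ominus>\<^bsub>R\<^esub> i) \<odot> lincomb a A'" using i lcl by (simp add: smult_l_minus smult_r_minus)
  hence "x = (\<ominus>\<^bsub>R\<^esub> i) \<odot> lincomb a A'" using i ax x smult_assoc1[of i "a x" x] by simp
  also have "\<dots> = (\<Oplus>b\<in>A'. (\<ominus>\<^bsub>R\<^esub> i) \<odot> (a b \<odot> b))"
    using A' BM i by (intro finsum_smult_ldistr) auto
  also have "\<dots> = lincomb (\<lambda>b. if b \<in> A' then \<ominus>\<^bsub>R\<^esub> i \<otimes>\<^bsub>R\<^esub> a b else \<zero>\<^bsub>R\<^esub>) A'"
    using A' BM i by (intro M.finsum_cong') (auto simp: smult_assoc1[symmetric] Pi_iff)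
  finally have "represents B (\<lambda>b. if b \<in> A' then \<ominus>\<^bsub>R\<^esub> i \<otimes>\<^bsub>R\<^esub> a b else \<zero>\<^bsub>R\<^esub>) x"
    using A' BM i by (subst represents_iff[where A = A']) (auto simp: Pi_iff)
  thus ?thesis by blast
qed

lemma ex_coordinates: "\<exists>B c. coordinates R M B c"
proof -
  obtain B where B: "indep B" "\<And>x. x \<in> carrier M \<Longrightarrow> indep (insert x B) \<Longrightarrow> x \<in> B"
    using ex_maximal_indep by blast
  \<comment> \<open>Uniqueness of representations removes the arbitrariness of the choice and yields
    the laws for the coordinates.\<close>
  define c where "c x = (SOME a. represents B a x)" for x
  have c: "represents B (c x) x" if "x \<in> carrier M" for x
    unfolding c_def using maximal_indep_represents[OF B that] by (rule someI_ex)
  have BM: "B \<subseteq> carrier M" using B(1) by (simp add: indep_def)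
  have eq: "c x = a" if "x \<in> carrier M" "represents B a x" for a x
    using represents_unique[OF B(1) c that(2)] that(1) by blast
  have "coordinates R M B c"
  proof unfold_locales
    fix x y b assume xy: "x \<in> carrier M" "y \<in> carrier M"
    show "c (x \<ominus> y) b = c x b \<ominus>\<^bsub>R\<^esub> c y b"
      using eq[OF _ represents_minus[OF BM c[OF xy(1)] c[OF xy(2)]]] xy by simp
  next
    fix x y assume xy: "x \<in> carrier M" "y \<in> carrier M" and e: "\<And>b. b \<in> B \<Longrightarrow> c x b = c y b"
    have "c x = c y" using c[OF xy(1)] c[OF xy(2)] e unfolding represents_def by (metis ext)
    thus "x = y" using c[OF xy(1)] c[OF xy(2)] unfolding represents_def by simp
  next
    fix r b b' assume "r \<in> carrier R" "b \<in> B"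
    thus "c (r \<odot> b) b' = (if b = b' then r else \<zero>\<^bsub>R\<^esub>)"
      using eq[OF _ represents_smult[OF BM]] BM by auto
  qed (use c BM in \<open>auto simp: represents_def\<close>)
  thus ?thesis by blast
qed

end

section \<open>Colour-preserving maps\<close>

text \<open>With \<open>u = s \<otimes> \<epsilon>\<close> the hypotheses say that \<open>u\<close>
  and \<open>r\<close> have equal squares and equal doubles, whence the square of their difference
  vanishes. There is no division by 2, so characteristic 2 is covered.\<close>

lemma (in field) eq_mult_if_squares_eq:
  assumes "s \<in> carrier R" "r \<in> carrier R" "\<epsilon> \<in> carrier R" "\<epsilon> \<otimes> \<epsilon> = \<one>" "s \<otimes> s = r \<otimes> r"
    "(s \<ominus> \<epsilon>) \<otimes> (s \<ominus> \<epsilon>) = (r \<ominus> \<one>) \<otimes> (r \<ominus> \<one>)"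
  shows "s = \<epsilon> \<otimes> r"
proof -
  define u where "u = s \<otimes> \<epsilon>"
  have u: "u \<in> carrier R" using assms by (simp add: u_def)
  have "(s \<ominus> \<epsilon>) \<otimes> (s \<ominus> \<epsilon>) = (s \<otimes> s \<oplus> \<epsilon> \<otimes> \<epsilon>) \<oplus> \<ominus> (u \<oplus> u)"
    using assms(1,3) unfolding u_def by algebra
  moreover have "(r \<ominus> \<one>) \<otimes> (r \<ominus> \<one>) = (r \<otimes> r \<oplus> \<one>) \<oplus> \<ominus> (r \<oplus> r)"
    using assms(2) by algebra
  ultimately have "(r \<otimes> r \<oplus> \<one>) \<oplus> \<ominus> (u \<oplus> u) = (r \<otimes> r \<oplus> \<one>) \<oplus> \<ominus> (r \<oplus> r)"
    using assms by simp
  hence "\<ominus> (u \<oplus> u) = \<ominus> (r \<oplus> r)" using u assms(2) by (subst (asm) add.l_cancel) auto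
  hence uu: "u \<oplus> u = r \<oplus> r" using u assms(2) by (metis add.m_closed minus_minus)
  have "u \<otimes> u = (s \<otimes> s) \<otimes> (\<epsilon> \<otimes> \<epsilon>)" using assms(1,3) unfolding u_def by algebra
  hence u2: "u \<otimes> u = r \<otimes> r" using assms by simp
  have "(u \<ominus> r) \<otimes> (u \<ominus> r) = (u \<otimes> u \<oplus> r \<otimes> r) \<ominus> (u \<oplus> u) \<otimes> r"
    using u assms(2) by algebra
  also have "\<dots> = \<zero>" unfolding uu u2 using assms(2) by algebra
  finally have "u = r" using u assms(2) by (simp add: integral_iff)
  have "s = s \<otimes> (\<epsilon> \<otimes> \<epsilon>)" using assms by simp
  also have "\<dots> = \<epsilon> \<otimes> u" using assms(1,3) unfolding u_def by algebra
  finally show ?thesis using \<open>u = r\<close> by simp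
qed

section \<open>Supports and colours of vectors\<close>

context coordinates
begin

abbreviation supp :: "'c \<Rightarrow> 'c set" where
  "supp x \<equiv> {b. c x b \<noteq> \<zero>\<^bsub>R\<^esub>}"

text \<open>Products of two coordinates, unlike single coordinates, do not change when the vector is
  negated, as the symmetry of the metric demands.\<close>

definition colour :: "('c \<Rightarrow> 'c \<Rightarrow> nat) \<Rightarrow> 'c \<Rightarrow> nat \<times> (nat \<times> 'a) set" where
  "colour e x = (card (supp x), (\<lambda>(a, b). (e a b, c x a \<otimes>\<^bsub>R\<^esub> c x b)) ` (supp x \<times> supp x))"

lemma supp_subset: "x \<in> carrier M \<Longrightarrow> supp x \<subseteq> B"
  using coord_outside by blast

lemma basis_in_carrier [simp]: "b \<in> B \<Longrightarrow> b \<in> carrier M"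
  using basis_closed by blast

lemma coord_zero [simp]: "c \<zero> b = \<zero>\<^bsub>R\<^esub>"
  using coord_minus[of \<zero> \<zero> b] M.r_neg[OF M.zero_closed] R.r_neg[of "c \<zero> b"]
  by (simp add: R.minus_eq M.minus_eq del: M.l_zero M.r_zero)

lemma coord_uminus: "x \<in> carrier M \<Longrightarrow> c (\<ominus> x) b = \<ominus>\<^bsub>R\<^esub> c x b"
  using coord_minus[of \<zero> x b] by (simp add: R.minus_eq M.minus_eq)

lemma colour_uminus: "x \<in> carrier M \<Longrightarrow> colour e (\<ominus> x) = colour e x"
proof -
  assume x: "x \<in> carrier M"
  have z: "\<ominus>\<^bsub>R\<^esub> r = \<zero>\<^bsub>R\<^esub> \<longleftrightarrow> r = \<zero>\<^bsub>R\<^esub>" if "r \<in> carrier R" for r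
    using that R.add.inv_eq_1_iff by (simp add: a_inv_def)
  have s: "supp (\<ominus> x) = supp x" using x by (simp add: coord_uminus z)
  have "c (\<ominus> x) a \<otimes>\<^bsub>R\<^esub> c (\<ominus> x) b = c x a \<otimes>\<^bsub>R\<^esub> c x b" for a b
    using x by (simp add: coord_uminus R.l_minus R.r_minus)
  thus ?thesis unfolding colour_def s by simp
qed

lemma supp_smult_basis: "b \<in> B \<Longrightarrow> r \<in> carrier R \<Longrightarrow> r \<noteq> \<zero>\<^bsub>R\<^esub> \<Longrightarrow> supp (r \<odot> b) = {b}"
  by (auto simp: coord_smult_basis)

lemma colour_smult_basis:
  assumes "b \<in> B" "r \<in> carrier R" "r \<noteq> \<zero>\<^bsub>R\<^esub>"
  shows "colour e (r \<odot> b) = (1, {(e b b, r \<otimes>\<^bsub>R\<^esub> r)})"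
  unfolding colour_def supp_smult_basis[OF assms] using assms by (simp add: coord_smult_basis)

lemma card_supp_eq_1:
  assumes "x \<in> carrier M" "card (supp x) = 1"
  obtains b r where "b \<in> B" "r \<in> carrier R" "r \<noteq> \<zero>\<^bsub>R\<^esub>" "x = r \<odot> b"
proof -
  obtain b where b: "supp x = {b}" using assms(2) card_1_singletonE by blast
  have bB: "b \<in> B" using supp_subset[OF assms(1)] b by blast
  have "x = c x b \<odot> b"
    using assms(1) bB b by (intro coord_inj) (auto simp: coord_smult_basis)
  thus thesis using that[of b "c x b"] bB b assms(1) by blast
qed

lemma coord_minus_smult_basis:
  assumes "x \<in> carrier M" "b \<in> B" "r \<in> carrier R"
  shows "c (x \<ominus> r \<odot> b) b' = (if b = b' then c x b \<ominus>\<^bsub>R\<^esub> r else c x b')"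
  using assms by (simp add: coord_minus coord_smult_basis R.minus_eq)

text \<open>Comparing the Hamming distances of \<open>x\<close> to zero and to
  \<open>r \<odot> b\<close> detects whether \<open>r\<close> is the coordinate of \<open>x\<close>
  at \<open>b\<close>. This is how Hamming isometries are seen to act coordinatewise.\<close>

lemma card_supp_less_iff:
  assumes "x \<in> carrier M" "b \<in> B" "r \<in> carrier R" "r \<noteq> \<zero>\<^bsub>R\<^esub>"
  shows "card (supp (x \<ominus> r \<odot> b)) < card (supp x) \<longleftrightarrow> c x b = r"
proof
  assume r: "c x b = r"
  have "supp (x \<ominus> r \<odot> b) \<subset> supp x"
    using assms r by (auto simp: coord_minus_smult_basis psubset_eq split: if_splits)
  thus "card (supp (x \<ominus> r \<odot> b)) < card (supp x)"
    using finite_support[OF assms(1)] by (rule psubset_card_mono[rotated])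
next
  assume less: "card (supp (x \<ominus> r \<odot> b)) < card (supp x)"
  show "c x b = r"
  proof (rule ccontr)
    assume "c x b \<noteq> r"
    hence "supp x \<subseteq> supp (x \<ominus> r \<odot> b)"
      using assms by (auto simp: coord_minus_smult_basis)
    hence "card (supp x) \<le> card (supp (x \<ominus> r \<odot> b))"
      using assms by (intro card_mono finite_support) auto
    thus False using less by simp
  qed
qed

lemma supp_two:
  assumes "b \<in> B" "b' \<in> B" "b \<noteq> b'" "r \<in> carrier R" "r' \<in> carrier R" "r \<noteq> \<zero>\<^bsub>R\<^esub>" "r' \<noteq> \<zero>\<^bsub>R\<^esub>"
  shows "supp (r \<odot> b \<ominus> r' \<odot> b') = {b, b'}"
    "c (r \<odot> b \<ominus> r' \<odot> b') b = r" "c (r \<odot> b \<ominus> r' \<odot> b') b' = \<ominus>\<^bsub>R\<^esub> r'"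
  using assms by (auto simp: coord_minus_smult_basis coord_smult_basis R.minus_eq)

lemma smult_minus_smult:
  assumes "b \<in> carrier M" "r \<in> carrier R" "r' \<in> carrier R"
  shows "r \<odot> b \<ominus> r' \<odot> b = (r \<ominus>\<^bsub>R\<^esub> r') \<odot> b"
  using assms by (simp add: R.minus_eq M.minus_eq smult_l_distr smult_l_minus)

lemma card_supp_smult_basis_le: "b \<in> B \<Longrightarrow> r \<in> carrier R \<Longrightarrow> card (supp (r \<odot> b)) \<le> 1"
  by (cases "r = \<zero>\<^bsub>R\<^esub>") (simp_all add: supp_smult_basis)

end

section \<open>Colour-preserving surjections that fix zero\<close>

locale colour_preserving = coordinates R M B c + rigid_colouring B e
  for R :: "('a, 'm) ring_scheme" and M :: "('a, 'c, 'n) module_scheme" (structure) and B c e +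
  fixes f :: "'c \<Rightarrow> 'c"
  assumes f_surj: "f ` carrier M = carrier M"
    and f_zero: "f \<zero> = \<zero>"
    and f_colour: "\<lbrakk>x \<in> carrier M; y \<in> carrier M\<rbrakk> \<Longrightarrow> colour e (f x \<ominus> f y) = colour e (x \<ominus> y)"
begin

lemma f_closed [simp]: "x \<in> carrier M \<Longrightarrow> f x \<in> carrier M"
  using f_surj by blast

lemma minus_zero_right [simp]: "x \<in> carrier M \<Longrightarrow> x \<ominus> \<zero> = x"
  using M.add.inv_one by (simp add: M.minus_eq a_inv_def)

lemma colour_f: "x \<in> carrier M \<Longrightarrow> colour e (f x) = colour e x"
  using f_colour[of x \<zero>] by (simp add: f_zero)

lemma card_supp_f_minus:
  "\<lbrakk>x \<in> carrier M; y \<in> carrier M\<rbrakk> \<Longrightarrow> card (supp (f x \<ominus> f y)) = card (supp (x \<ominus> y))"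
  using f_colour[of x y] by (simp add: colour_def)

lemma card_supp_f: "x \<in> carrier M \<Longrightarrow> card (supp (f x)) = card (supp x)"
  using colour_f[of x] by (simp add: colour_def)

text \<open>A support of size 1 characterises the nonzero multiples of basis vectors, and the colour
  of such a vector is a single tagged square.\<close>

lemma f_smult_basis_ex:
  assumes "b \<in> B" "r \<in> carrier R" "r \<noteq> \<zero>\<^bsub>R\<^esub>"
  shows "\<exists>b' s. b' \<in> B \<and> s \<in> carrier R \<and> s \<noteq> \<zero>\<^bsub>R\<^esub> \<and> f (r \<odot> b) = s \<odot> b' \<and>
    s \<otimes>\<^bsub>R\<^esub> s = r \<otimes>\<^bsub>R\<^esub> r \<and> e b' b' = e b b"
proof -
  have x: "r \<odot> b \<in> carrier M" using assms by simp
  have "card (supp (f (r \<odot> b))) = 1" using card_supp_f[OF x] assms by (simp add: supp_smult_basis)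
  then obtain b' s where b': "b' \<in> B" "s \<in> carrier R" "s \<noteq> \<zero>\<^bsub>R\<^esub>" "f (r \<odot> b) = s \<odot> b'"
    using card_supp_eq_1[OF f_closed[OF x]] by metis
  have "colour e (s \<odot> b') = colour e (r \<odot> b)" using colour_f[OF x] b' by simp
  thus ?thesis using b' assms by (auto simp: colour_smult_basis)
qed

lemma f_basis_ex:
  "b \<in> B \<Longrightarrow> \<exists>p. fst p \<in> B \<and> snd p \<in> carrier R \<and> snd p \<noteq> \<zero>\<^bsub>R\<^esub> \<and> f b = snd p \<odot> fst p \<and>
    snd p \<otimes>\<^bsub>R\<^esub> snd p = \<one>\<^bsub>R\<^esub> \<and> e (fst p) (fst p) = e b b"
  using f_smult_basis_ex[of b "\<one>\<^bsub>R\<^esub>"] by simp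

definition image where
  "image b = (SOME p. fst p \<in> B \<and> snd p \<in> carrier R \<and> snd p \<noteq> \<zero>\<^bsub>R\<^esub> \<and> f b = snd p \<odot> fst p \<and>
    snd p \<otimes>\<^bsub>R\<^esub> snd p = \<one>\<^bsub>R\<^esub> \<and> e (fst p) (fst p) = e b b)"

definition \<pi> where "\<pi> b = fst (image b)"

definition \<epsilon> where "\<epsilon> b = snd (image b)"

lemma f_basis:
  assumes "b \<in> B"
  shows "\<pi> b \<in> B" "\<epsilon> b \<in> carrier R" "\<epsilon> b \<noteq> \<zero>\<^bsub>R\<^esub>" "f b = \<epsilon> b \<odot> \<pi> b"
    "\<epsilon> b \<otimes>\<^bsub>R\<^esub> \<epsilon> b = \<one>\<^bsub>R\<^esub>" "e (\<pi> b) (\<pi> b) = e b b"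
  using someI_ex[OF f_basis_ex[OF assms]] unfolding image_def[symmetric] \<pi>_def[symmetric] \<epsilon>_def[symmetric]
  by blast+

lemma f_smult_basis:
  assumes b: "b \<in> B" and r: "r \<in> carrier R"
  shows "f (r \<odot> b) = (\<epsilon> b \<otimes>\<^bsub>R\<^esub> r) \<odot> \<pi> b"
proof -
  note fb = f_basis[OF b]
  consider "r = \<zero>\<^bsub>R\<^esub>" | "r = \<one>\<^bsub>R\<^esub>" | "r \<noteq> \<zero>\<^bsub>R\<^esub>" "r \<noteq> \<one>\<^bsub>R\<^esub>" by blast
  thus ?thesis
  proof cases
    \<comment> \<open>Excluding 0 and 1 ensures that both \<open>r \<odot> b\<close> and its
      difference from \<open>b\<close> have one-element support, so that both colours are single
      tagged squares.\<close>
    case 3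
    obtain b' s where s: "b' \<in> B" "s \<in> carrier R" "s \<noteq> \<zero>\<^bsub>R\<^esub>" "f (r \<odot> b) = s \<odot> b'" "s \<otimes>\<^bsub>R\<^esub> s = r \<otimes>\<^bsub>R\<^esub> r"
      using f_smult_basis_ex[OF b r 3(1)] by blast
    have r1: "r \<ominus>\<^bsub>R\<^esub> \<one>\<^bsub>R\<^esub> \<in> carrier R" "r \<ominus>\<^bsub>R\<^esub> \<one>\<^bsub>R\<^esub> \<noteq> \<zero>\<^bsub>R\<^esub>" using r 3 by simp_all
    have "colour e (s \<odot> b' \<ominus> \<epsilon> b \<odot> \<pi> b) = colour e (r \<odot> b \<ominus> \<one>\<^bsub>R\<^esub> \<odot> b)"
      using f_colour[of "r \<odot> b" b] b r s fb by simp
    also have "\<dots> = colour e ((r \<ominus>\<^bsub>R\<^esub> \<one>\<^bsub>R\<^esub>) \<odot> b)" using b r by (simp only: smult_minus_smult basis_in_carrier R.one_closed)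
    also have "\<dots> = (1, {(e b b, (r \<ominus>\<^bsub>R\<^esub> \<one>\<^bsub>R\<^esub>) \<otimes>\<^bsub>R\<^esub> (r \<ominus>\<^bsub>R\<^esub> \<one>\<^bsub>R\<^esub>))})"
      by (rule colour_smult_basis[OF b r1])
    finally have col: "colour e (s \<odot> b' \<ominus> \<epsilon> b \<odot> \<pi> b) = \<dots>" .
    have "b' = \<pi> b"
    proof (rule ccontr)
      assume ne: "b' \<noteq> \<pi> b"
      have "card (supp (s \<odot> b' \<ominus> \<epsilon> b \<odot> \<pi> b)) = 2"
        unfolding supp_two(1)[OF s(1) fb(1) ne s(2) fb(2) s(3) fb(3)] using ne by simp
      thus False using col by (simp add: colour_def)
    qed
    hence col': "colour e ((s \<ominus>\<^bsub>R\<^esub> \<epsilon> b) \<odot> \<pi> b) = (1, {(e b b, (r \<ominus>\<^bsub>R\<^esub> \<one>\<^bsub>R\<^esub>) \<otimes>\<^bsub>R\<^esub> (r \<ominus>\<^bsub>R\<^esub> \<one>\<^bsub>R\<^esub>))})"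
      using col s fb by (simp add: smult_minus_smult)
    have eq: "v = u" if "(1::nat, {(k::nat, u)}) = (1, {(l, v)})" for k l and u v :: 'a
      using that by simp
    \<comment> \<open>A zero scalar would give an empty support, whereas the colour records size
      1.\<close>
    have "s \<ominus>\<^bsub>R\<^esub> \<epsilon> b \<noteq> \<zero>\<^bsub>R\<^esub>"
      using col' fb by (auto simp: colour_def)
    from colour_smult_basis[OF fb(1) R.minus_closed[OF s(2) fb(2)] this, of e]
    have "(s \<ominus>\<^bsub>R\<^esub> \<epsilon> b) \<otimes>\<^bsub>R\<^esub> (s \<ominus>\<^bsub>R\<^esub> \<epsilon> b) = (r \<ominus>\<^bsub>R\<^esub> \<one>\<^bsub>R\<^esub>) \<otimes>\<^bsub>R\<^esub> (r \<ominus>\<^bsub>R\<^esub> \<one>\<^bsub>R\<^esub>)"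
      unfolding col' by (rule eq)
    hence "s = \<epsilon> b \<otimes>\<^bsub>R\<^esub> r" by (rule R.eq_mult_if_squares_eq[OF s(2) r fb(2,5) s(5)])
    thus ?thesis using s(4) \<open>b' = \<pi> b\<close> by (simp only:)
  qed (use b fb f_zero in simp_all)
qed

text \<open>The difference of two distinct basis vectors has support of size 2, so their images
  cannot be multiples of one basis vector. The mixed product of the image must then match the mixed
  product -1 of the original, because its tag is not a diagonal colour.\<close>

lemma f_basis_pair:
  assumes b: "b \<in> B" "b' \<in> B" "b \<noteq> b'"
  shows "\<pi> b \<noteq> \<pi> b'" "e (\<pi> b) (\<pi> b') = e b b'" "\<epsilon> b = \<epsilon> b'"
proof -
  note fb = f_basis[OF b(1)] and fb' = f_basis[OF b(2)]
  note s1 = supp_two[OF b R.one_closed R.one_closed R.one_not_zero R.one_not_zero]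
  have col: "colour e (\<epsilon> b \<odot> \<pi> b \<ominus> \<epsilon> b' \<odot> \<pi> b') = colour e (\<one>\<^bsub>R\<^esub> \<odot> b \<ominus> \<one>\<^bsub>R\<^esub> \<odot> b')"
    using f_colour[of b b'] b fb fb' by simp
  show ne: "\<pi> b \<noteq> \<pi> b'"
  proof
    assume "\<pi> b = \<pi> b'"
    hence "card (supp (\<epsilon> b \<odot> \<pi> b \<ominus> \<epsilon> b' \<odot> \<pi> b')) \<le> 1"
      using card_supp_smult_basis_le fb fb' by (simp add: smult_minus_smult)
    moreover have "card (supp (\<epsilon> b \<odot> \<pi> b \<ominus> \<epsilon> b' \<odot> \<pi> b')) = 2"
      using col b s1 by (simp add: colour_def)
    ultimately show False by simp
  qed
  note s2 = supp_two[OF fb(1) fb'(1) ne fb(2) fb'(2) fb(3) fb'(3)]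
  have "(e (\<pi> b) (\<pi> b'), \<epsilon> b \<otimes>\<^bsub>R\<^esub> \<ominus>\<^bsub>R\<^esub> \<epsilon> b') \<in> snd (colour e (\<epsilon> b \<odot> \<pi> b \<ominus> \<epsilon> b' \<odot> \<pi> b'))"
    unfolding colour_def s2(1) snd_conv using s2(2,3) by (intro image_eqI[of _ _ "(\<pi> b, \<pi> b')"]) auto
  hence "(e (\<pi> b) (\<pi> b'), \<epsilon> b \<otimes>\<^bsub>R\<^esub> \<ominus>\<^bsub>R\<^esub> \<epsilon> b') \<in>
      {(e b b, \<one>\<^bsub>R\<^esub>), (e b' b', \<one>\<^bsub>R\<^esub>), (e b b', \<ominus>\<^bsub>R\<^esub> \<one>\<^bsub>R\<^esub>)}"
    unfolding col unfolding colour_def s1(1) snd_conv using s1(2,3) e_sym[of b b']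
    by (auto simp: R.l_minus R.r_minus)
  moreover have "e (\<pi> b) (\<pi> b') \<noteq> e b b" "e (\<pi> b) (\<pi> b') \<noteq> e b' b'"
    using e_diag[of "\<pi> b" "\<pi> b" "\<pi> b'"] e_diag[of "\<pi> b'" "\<pi> b" "\<pi> b'"] fb fb' ne by auto
  ultimately have *: "e (\<pi> b) (\<pi> b') = e b b'" "\<epsilon> b \<otimes>\<^bsub>R\<^esub> \<ominus>\<^bsub>R\<^esub> \<epsilon> b' = \<ominus>\<^bsub>R\<^esub> \<one>\<^bsub>R\<^esub>" by auto
  show "e (\<pi> b) (\<pi> b') = e b b'" by (fact *(1))
  have "\<epsilon> b \<otimes>\<^bsub>R\<^esub> \<epsilon> b' = \<one>\<^bsub>R\<^esub>"
    using *(2) fb fb' by (metis R.m_closed R.minus_minus R.one_closed R.r_minus)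
  thus "\<epsilon> b = \<epsilon> b'" using fb fb' by (metis R.m_assoc R.r_one R.l_one)
qed

lemma \<pi>_id: "b \<in> B \<Longrightarrow> \<pi> b = b"
proof (rule e_rigid)
  show "bij_betw \<pi> B B"
  proof (rule bij_betw_imageI)
    show "inj_on \<pi> B" using f_basis_pair(1) by (auto simp: inj_on_def)
    show "\<pi> ` B = B"
    proof
      show "\<pi> ` B \<subseteq> B" using f_basis(1) by blast
      show "B \<subseteq> \<pi> ` B"
      proof
        \<comment> \<open>A preimage of \<open>b\<close> under \<open>f\<close> has support of size
          1, hence is a multiple of some \<open>b'\<close>, and then \<pi> sends \<open>b'\<close>
          to \<open>b\<close>.\<close>
        fix b assume b: "b \<in> B"
        then obtain x where x: "x \<in> carrier M" "f x = b" using f_surj basis_in_carrier by (metis imageE)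
        have "card (supp x) = 1"
          using card_supp_f[OF x(1)] x(2) supp_smult_basis[OF b R.one_closed R.one_not_zero] b by simp
        then obtain b' r where r: "b' \<in> B" "r \<in> carrier R" "r \<noteq> \<zero>\<^bsub>R\<^esub>" "x = r \<odot> b'"
          using card_supp_eq_1[OF x(1)] by metis
        have "(\<epsilon> b' \<otimes>\<^bsub>R\<^esub> r) \<odot> \<pi> b' = \<one>\<^bsub>R\<^esub> \<odot> b" using f_smult_basis[OF r(1,2)] r(4) x(2) b by simp
        hence "supp ((\<epsilon> b' \<otimes>\<^bsub>R\<^esub> r) \<odot> \<pi> b') = supp (\<one>\<^bsub>R\<^esub> \<odot> b)" by (simp only:)
        hence "\<pi> b' = b"
          using supp_smult_basis[OF b R.one_closed R.one_not_zero] f_basis[OF r(1)] r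
            supp_smult_basis[of "\<pi> b'" "\<epsilon> b' \<otimes>\<^bsub>R\<^esub> r"] by (simp add: R.integral_iff)
        thus "b \<in> \<pi> ` B" using r(1) by blast
      qed
    qed
  qed
  fix a b assume "a \<in> B" "b \<in> B"
  thus "e (\<pi> a) (\<pi> b) = e a b" using f_basis(6) f_basis_pair(2) by (cases "a = b") auto
qed

text \<open>One scalar \<eta> with square 1 serves all basis vectors. Hamming distances to multiples
  of basis vectors spread multiplication by \<eta> to every coordinate of every vector, and in a
  field \<eta> is 1 or -1.\<close>

theorem f_cases: "(\<forall>x\<in>carrier M. f x = x) \<or> (\<forall>x\<in>carrier M. f x = \<ominus> x)"
proof (cases "B = {}")
  case True
  hence "x = y" if "x \<in> carrier M" "y \<in> carrier M" for x y using coord_inj[OF that] by blast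
  thus ?thesis by (metis f_closed)
next
  case False
  then obtain b0 where b0: "b0 \<in> B" by blast
  define \<eta> where "\<eta> = \<epsilon> b0"
  have \<eta>: "\<eta> \<in> carrier R" "\<eta> \<noteq> \<zero>\<^bsub>R\<^esub>" "\<eta> \<otimes>\<^bsub>R\<^esub> \<eta> = \<one>\<^bsub>R\<^esub>" using f_basis[OF b0] by (simp_all add: \<eta>_def)
  have f: "f (r \<odot> b) = (\<eta> \<otimes>\<^bsub>R\<^esub> r) \<odot> b" if "b \<in> B" "r \<in> carrier R" for r b
    using f_smult_basis[OF that] \<pi>_id[OF that(1)] f_basis_pair(3)[OF that(1) b0] by (cases "b = b0") (auto simp: \<eta>_def)
  have coord_iff: "c (f x) b = \<eta> \<otimes>\<^bsub>R\<^esub> r \<longleftrightarrow> c x b = r"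
    if x: "x \<in> carrier M" and b: "b \<in> B" and r: "r \<in> carrier R" "r \<noteq> \<zero>\<^bsub>R\<^esub>" for x b r
  proof -
    have "card (supp (f x \<ominus> (\<eta> \<otimes>\<^bsub>R\<^esub> r) \<odot> b)) = card (supp (x \<ominus> r \<odot> b))"
      using card_supp_f_minus[OF x, of "r \<odot> b"] f[OF b r(1)] b r by simp
    thus ?thesis
      using card_supp_less_iff[OF x b r] card_supp_less_iff[of "f x" b "\<eta> \<otimes>\<^bsub>R\<^esub> r"] \<eta> r b x card_supp_f[OF x]
      by (simp add: R.integral_iff)
  qed
  have coord: "c (f x) b = \<eta> \<otimes>\<^bsub>R\<^esub> c x b" if x: "x \<in> carrier M" and b: "b \<in> B" for x b
  proof (cases "c x b = \<zero>\<^bsub>R\<^esub>")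
    case True
    \<comment> \<open>Since \<eta> is its own inverse, \<open>r\<close> is the value that
      \<open>coord_iff\<close> would assign to the coordinate of \<open>x\<close>; were it nonzero,
      that coordinate would be nonzero as well.\<close>
    define r where "r = \<eta> \<otimes>\<^bsub>R\<^esub> c (f x) b"
    have r: "r \<in> carrier R" "\<eta> \<otimes>\<^bsub>R\<^esub> r = c (f x) b"
      using \<eta> x R.m_assoc[of \<eta> \<eta> "c (f x) b"] by (simp_all add: r_def)
    hence "r = \<zero>\<^bsub>R\<^esub>" using coord_iff[OF x b, of r] True by auto
    thus ?thesis using r True by simp
  next
    case False thus ?thesis using coord_iff[OF x b] x by blast
  qed
  have "(\<eta> \<ominus>\<^bsub>R\<^esub> \<one>\<^bsub>R\<^esub>) \<otimes>\<^bsub>R\<^esub> (\<eta> \<oplus>\<^bsub>R\<^esub> \<one>\<^bsub>R\<^esub>) = \<eta> \<otimes>\<^bsub>R\<^esub> \<eta> \<ominus>\<^bsub>R\<^esub> \<one>\<^bsub>R\<^esub>" using \<eta>(1) by algebra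
  also have "\<dots> = \<zero>\<^bsub>R\<^esub>" using \<eta>(3) by (simp add: R.minus_eq R.r_neg)
  finally have "\<eta> \<ominus>\<^bsub>R\<^esub> \<one>\<^bsub>R\<^esub> = \<zero>\<^bsub>R\<^esub> \<or> \<eta> \<oplus>\<^bsub>R\<^esub> \<one>\<^bsub>R\<^esub> = \<zero>\<^bsub>R\<^esub>"
    using \<eta> by (simp add: R.integral_iff)
  hence "\<eta> = \<one>\<^bsub>R\<^esub> \<or> \<eta> = \<ominus>\<^bsub>R\<^esub> \<one>\<^bsub>R\<^esub>" using \<eta>(1) R.minus_equality[of \<eta> "\<one>\<^bsub>R\<^esub>"] by auto
  thus ?thesis
  proof
    assume "\<eta> = \<one>\<^bsub>R\<^esub>"
    hence "\<forall>x\<in>carrier M. f x = x" using coord by (auto intro!: coord_inj)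
    thus ?thesis ..
  next
    assume "\<eta> = \<ominus>\<^bsub>R\<^esub> \<one>\<^bsub>R\<^esub>"
    hence "\<forall>x\<in>carrier M. f x = \<ominus> x"
      using coord by (auto intro!: coord_inj simp: coord_uminus R.l_minus)
    thus ?thesis ..
  qed
qed

end

section \<open>Naturality\<close>

lemma natural_group_if_coordinates:
  fixes R :: "('a, 'm) ring_scheme" and M :: "('a, 'v, 'n) module_scheme" (structure)
  assumes "coordinates R M B c" and countable_R: "countable (carrier R)"
  shows "natural_group (add_monoid M)"
proof -
  interpret coordinates R M B c by fact
  obtain e where "rigid_colouring B e" using ex_rigid_colouring by blast
  then interpret rigid_colouring B e .
  \<comment> \<open>This countable set contains all colours of vectors, so that
    \<open>to_nat_on C\<close> is injective on them.\<close>
  define C where "C = (UNIV :: nat set) \<times> {S. finite S \<and> S \<subseteq> (UNIV :: nat set) \<times> carrier R}"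
  have "countable C"
    unfolding C_def using countable_R by (intro countable_SIGMA countable_Collect_finite_subset) auto
  have colC: "colour e x \<in> C" if "x \<in> carrier M" for x
    using that finite_support[OF that] unfolding C_def colour_def by auto
  define code :: "nat \<times> (nat \<times> 'a) set \<Rightarrow> real" where "code k = 1 + inverse (1 + real (to_nat_on C k))" for k
  have code: "1 < code k" "code k \<le> 2" for k by (auto simp: code_def field_simps)
  have code_inj: "k = k'" if "code k = code k'" "k \<in> C" "k' \<in> C" for k k'
    using that \<open>countable C\<close> by (simp add: code_def)
  \<comment> \<open>The locale \<open>Metric_space\<close> requires nonnegativity and symmetry also outside the carrier.\<close>
  define d where "d x y = (if x = y then 0
    else if x \<in> carrier M \<and> y \<in> carrier M then code (colour e (x \<ominus> y)) else 2)" for x y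
  have pos: "1 < d x y" "d x y \<le> 2" if "x \<noteq> y" for x y using that code by (simp_all add: d_def)
  have cancel: "(x \<oplus> g) \<ominus> (y \<oplus> g) = x \<ominus> y" if "x \<in> carrier M" "y \<in> carrier M" "g \<in> carrier M" for x y g
  proof -
    have "(x \<oplus> g) \<ominus> (y \<oplus> g) = (x \<ominus> y) \<oplus> (g \<oplus> \<ominus> g)"
      using that by (simp add: M.minus_eq M.minus_add M.a_ac del: M.r_neg)
    thus ?thesis using that by (simp add: M.r_neg)
  qed
  have rinv: "right_invariant_metric (add_monoid M) d"
    unfolding right_invariant_metric_def
  proof (intro conjI ballI)
    show "Metric_space (carrier (add_monoid M)) d"
    proof
      fix x y show "0 \<le> d x y" using pos[of x y] by (cases "x = y") (auto simp: d_def)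
    next
      fix x y
      have "colour e (x \<ominus> y) = colour e (y \<ominus> x)" if "x \<in> carrier M" "y \<in> carrier M"
        using colour_uminus[of "y \<ominus> x" e] that by (simp add: M.minus_eq M.minus_add M.a_comm)
      thus "d x y = d y x" by (simp add: d_def)
    next
      fix x y show "d x y = 0 \<longleftrightarrow> x = y" using pos[of x y] by (auto simp: d_def)
    next
      \<comment> \<open>For distinct points the left side is at most 2 and each summand on the right
        exceeds 1.\<close>
      fix x y z show "d x z \<le> d x y + d y z" 
        using pos[of x y] pos[of x z] pos[of y z] by (cases "x = y"; cases "y = z"; cases "x = z") (auto simp: d_def)
    qed
  next
    fix x y g assume "x \<in> carrier (add_monoid M)" "y \<in> carrier (add_monoid M)" "g \<in> carrier (add_monoid M)"
    thus "d (x \<otimes>\<^bsub>add_monoid M\<^esub> g) (y \<otimes>\<^bsub>add_monoid M\<^esub> g) = d x y" by (simp add: d_def cancel)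
  qed
  have "naturalizing_metric (add_monoid M) d"
    unfolding naturalizing_metric_def
  proof (intro conjI allI impI rinv)
    fix H :: "'v monoid"
    assume "group H" and car: "carrier H = carrier (add_monoid M)"
      and iso: "\<forall>g\<in>carrier H. isometry_of (carrier (add_monoid M)) d (\<lambda>x. x \<otimes>\<^bsub>H\<^esub> g)"
    interpret H: group H by fact
    have car [simp]: "carrier H = carrier M" using car by simp
    have Hcl [simp]: "x \<otimes>\<^bsub>H\<^esub> g \<in> carrier M" if "x \<in> carrier M" "g \<in> carrier M" for x g
      using H.m_closed that by simp
    \<comment> \<open>If right translation by \<open>g\<close> is to be a translation of the vector
      space, its vector must be the image of zero. The identity of \<open>H\<close> may be another
      element.\<close>
    define \<phi> where "\<phi> g = \<zero> \<otimes>\<^bsub>H\<^esub> g" for g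
    have \<phi>_closed [simp]: "\<phi> g \<in> carrier M" if "g \<in> carrier M" for g using that by (simp add: \<phi>_def)
    have translation: "x \<otimes>\<^bsub>H\<^esub> g = x \<oplus> \<phi> g" if g: "g \<in> carrier M" and x: "x \<in> carrier M" for x g
    proof -
      \<comment> \<open>Subtracting the image of zero normalises the right translation to a map
        fixing zero, to which \<open>f_cases\<close> applies.\<close>
      define f where "f x = x \<otimes>\<^bsub>H\<^esub> g \<ominus> \<phi> g" for x
      have im: "(\<lambda>x. x \<otimes>\<^bsub>H\<^esub> g) ` carrier M = carrier M"
        and dist: "\<And>x y. x \<in> carrier M \<Longrightarrow> y \<in> carrier M \<Longrightarrow> d (x \<otimes>\<^bsub>H\<^esub> g) (y \<otimes>\<^bsub>H\<^esub> g) = d x y"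
        using iso g by (simp_all add: isometry_of_def)
      have xf: "x \<otimes>\<^bsub>H\<^esub> g = f x \<oplus> \<phi> g" if "x \<in> carrier M" for x
        using that g by (simp add: f_def M.minus_eq M.a_assoc M.l_neg)
      have fcl: "f x \<in> carrier M" if "x \<in> carrier M" for x using that g by (simp add: f_def)
      have "colour_preserving R M B c e f"
      proof unfold_locales
        show "f ` carrier M = carrier M"
        proof
          show "f ` carrier M \<subseteq> carrier M" using fcl by blast
          show "carrier M \<subseteq> f ` carrier M"
          proof
            fix y assume y: "y \<in> carrier M"
            hence "y \<oplus> \<phi> g \<in> (\<lambda>x. x \<otimes>\<^bsub>H\<^esub> g) ` carrier M" using g im by simp
            then obtain x where "x \<in> carrier M" "y \<oplus> \<phi> g = x \<otimes>\<^bsub>H\<^esub> g" by blast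
            thus "y \<in> f ` carrier M" using xf[of x] fcl y g by auto
          qed
        qed
        show "f \<zero> = \<zero>" using g M.r_neg by (simp add: f_def \<phi>_def M.minus_eq)
      next
        fix x y assume xy: "x \<in> carrier M" "y \<in> carrier M"
        show "colour e (f x \<ominus> f y) = colour e (x \<ominus> y)"
        proof (cases "x = y")
          case True thus ?thesis using xy fcl by (simp add: M.minus_eq M.r_neg)
        next
          case False
          hence "x \<otimes>\<^bsub>H\<^esub> g \<noteq> y \<otimes>\<^bsub>H\<^esub> g" using xy g by simp
          hence "code (colour e (x \<otimes>\<^bsub>H\<^esub> g \<ominus> y \<otimes>\<^bsub>H\<^esub> g)) = code (colour e (x \<ominus> y))"
            using dist[OF xy] False xy g by (simp add: d_def)
          hence "colour e (x \<otimes>\<^bsub>H\<^esub> g \<ominus> y \<otimes>\<^bsub>H\<^esub> g) = colour e (x \<ominus> y)"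
            using xy g by (intro code_inj colC) auto
          thus ?thesis using cancel[of "f x" "f y" "\<phi> g"] xf xy fcl g by simp
        qed
      qed
      then interpret colour_preserving R M B c e f .
      show ?thesis
      proof (cases "\<forall>x\<in>carrier M. f x = x")
        case True thus ?thesis using xf x by simp
      next
        case False
        hence neg: "f y = \<ominus> y" if "y \<in> carrier M" for y using f_cases that by blast
        show ?thesis
        proof (cases "\<one>\<^bsub>R\<^esub> \<oplus>\<^bsub>R\<^esub> \<one>\<^bsub>R\<^esub> = \<zero>\<^bsub>R\<^esub>")
          case True
          \<comment> \<open>In characteristic 2 negation is the identity, so the two alternatives
            coincide.\<close>
          have "x \<oplus> x = (\<one>\<^bsub>R\<^esub> \<oplus>\<^bsub>R\<^esub> \<one>\<^bsub>R\<^esub>) \<odot> x" using x by (subst smult_l_distr) auto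
          hence "\<ominus> x = x" using True x by (simp add: M.minus_equality)
          thus ?thesis using xf[OF x] neg[OF x] by simp
        next
          case False
          define h where "h = inv\<^bsub>R\<^esub> (\<one>\<^bsub>R\<^esub> \<oplus>\<^bsub>R\<^esub> \<one>\<^bsub>R\<^esub>)"
          have h: "h \<in> carrier R" "(\<one>\<^bsub>R\<^esub> \<oplus>\<^bsub>R\<^esub> \<one>\<^bsub>R\<^esub>) \<otimes>\<^bsub>R\<^esub> h = \<one>\<^bsub>R\<^esub>"
            using False R.field_Units unfolding h_def by auto
          \<comment> \<open>Half of \<open>\<phi> g\<close> is a fixed point of the reflection
            sending \<open>x\<close> to \<open>\<phi> g \<ominus> x\<close>. In a group only the
            identity has a right translation with a fixed point.\<close>
          define u where "u = h \<odot> \<phi> g"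
          have u: "u \<in> carrier M" using h g by (simp add: u_def)
          have "u \<oplus> u = (\<one>\<^bsub>R\<^esub> \<oplus>\<^bsub>R\<^esub> \<one>\<^bsub>R\<^esub>) \<odot> u" using u by (subst smult_l_distr) auto
          also have "\<dots> = \<phi> g" using h g by (simp add: u_def smult_assoc1[symmetric])
          finally have "u \<otimes>\<^bsub>H\<^esub> g = \<ominus> u \<oplus> (u \<oplus> u)" using xf[OF u] neg[OF u] by simp
          also have "\<dots> = u" using u by (simp add: M.a_assoc[symmetric] M.l_neg)
          finally have "g = \<one>\<^bsub>H\<^esub>" using u g H.r_cancel_one'[of u g] H.l_cancel_one[of u g] by simp
          hence "\<phi> g = \<zero>" "x \<otimes>\<^bsub>H\<^esub> g = x" using x by (simp_all add: \<phi>_def)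
          thus ?thesis using x by simp
        qed
      qed
    qed
    have "\<phi> \<in> Group.iso H (add_monoid M)"
    proof (rule isoI)
      show "\<phi> \<in> hom H (add_monoid M)"
      proof (rule homI)
        fix g g' assume g: "g \<in> carrier H" "g' \<in> carrier H"
        \<comment> \<open>Associativity of \<open>H\<close> turns the image of zero under a product
          into the \<open>g'\<close>-translate of \<open>\<phi> g\<close>, which
          \<open>translation\<close> evaluates as a sum.\<close>
        have "\<phi> (g \<otimes>\<^bsub>H\<^esub> g') = \<phi> g \<otimes>\<^bsub>H\<^esub> g'" using g H.m_assoc[of \<zero> g g'] by (simp add: \<phi>_def)
        thus "\<phi> (g \<otimes>\<^bsub>H\<^esub> g') = \<phi> g \<otimes>\<^bsub>add_monoid M\<^esub> \<phi> g'" using g translation by simp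
      qed simp
      show "bij_betw \<phi> (carrier H) (carrier (add_monoid M))"
      proof (rule bij_betw_imageI)
        show "inj_on \<phi> (carrier H)" by (rule inj_onI) (simp add: \<phi>_def)
        have "y \<in> \<phi> ` carrier M" if "y \<in> carrier M" for y
        proof (rule image_eqI)
          show "y = \<phi> (inv\<^bsub>H\<^esub> \<zero> \<otimes>\<^bsub>H\<^esub> y)"
            using that H.m_assoc[of \<zero> "inv\<^bsub>H\<^esub> \<zero>" y] H.inv_closed[of \<zero>] H.r_inv[of \<zero>] by (simp add: \<phi>_def)
          show "inv\<^bsub>H\<^esub> \<zero> \<otimes>\<^bsub>H\<^esub> y \<in> carrier M" using that H.inv_closed[of \<zero>] by simp
        qed
        thus "\<phi> ` carrier H = carrier (add_monoid M)" by auto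
      qed
    qed
    thus "H \<cong> add_monoid M" by (auto simp: is_iso_def)
  qed
  thus ?thesis unfolding natural_group_def using M.a_group by blast
qed

section \<open>Vector spaces over countable fields and arbitrary fields\<close>

theorem natural_group_vector_space:
  assumes "field R" "module R M" "countable (carrier R)"
  shows "natural_group (add_monoid M)"
proof -
  interpret vector_module R M using assms by (simp add: vector_module_def)
  obtain B c where "coordinates R M B c" using ex_coordinates by blast
  thus ?thesis using assms(3) by (rule natural_group_if_coordinates)
qed

text \<open>Needed because additive monoids built from a module and from a ring may be records with
  different extensions, although their carrier, operation and identity agree.\<close>

lemma natural_group_cong:
  assumes "natural_group G" "carrier G' = carrier G" "monoid.mult G' = monoid.mult G" "one G' = one G"
  shows "natural_group G'"
proof -
  obtain d where d: "group G" "naturalizing_metric G d" using assms(1) by (auto simp: natural_group_def)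
  interpret G: group G by fact
  have "group G'"
    by (rule groupI) (auto simp: assms(2-) G.m_assoc intro: G.l_inv_ex)
  moreover have "naturalizing_metric G' d"
    using d(2) by (simp add: naturalizing_metric_def right_invariant_metric_def assms(2-)
        is_iso_def Group.iso_def hom_def)
  ultimately show ?thesis by (auto simp: natural_group_def)
qed

lemma natural_group_field:
  fixes K :: "('k, 'm) ring_scheme"
  assumes "field K"
  shows "natural_group (add_monoid K)"
proof -
  interpret K: field K by fact
  define P where "P = generate_field K {}"
  have sub: "subfield P K" unfolding P_def by (rule K.generate_field_is_subfield) simp
  have PK: "P \<subseteq> carrier K" using subfieldE(3)[OF sub] .
  define R where "R = K\<lparr>carrier := P\<rparr>"
  \<comment> \<open>The field \<open>K\<close> regarded as a vector space over its prime field
    \<open>P\<close>, with scalar multiplication given by the multiplication of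
    \<open>K\<close>.\<close>
  define M :: "('k, 'k) module" where
    "M = \<lparr>carrier = carrier K, monoid.mult = monoid.mult K, one = \<one>\<^bsub>K\<^esub>, zero = \<zero>\<^bsub>K\<^esub>, add = add K,
      module.smult = monoid.mult K\<rparr>"
  have R: "field R" unfolding R_def by (rule K.subfield_iff(2)[OF sub])
  have "abelian_group M"
    by (rule abelian_groupI) (auto simp: M_def K.a_ac intro: bexI[OF _ K.a_inv_closed] K.r_neg)
  hence "module R M"
    using PK R by (intro moduleI) (auto simp: R_def M_def field_def domain_def K.l_distr K.r_distr K.m_assoc subset_iff)
  moreover have "countable (carrier R)" by (simp add: R_def P_def countable_generate_field_empty)
  ultimately have "natural_group (add_monoid M)" using R by (intro natural_group_vector_space)
  thus ?thesis by (rule natural_group_cong) (simp_all add: M_def)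
qed

theorem corollary1p3:
  shows "(\<forall>K :: ('k, 'm) ring_scheme. Ring.field K \<longrightarrow> natural_group (add_monoid K)) \<and>
         (\<forall>V :: (rat, 'v, 'n) module_scheme.
            Module.module rat_field V \<longrightarrow> natural_group (add_monoid V)) \<and>
         (\<forall>p :: nat. prime p \<longrightarrow>
            (\<forall>W :: (int, 'w, 'l) module_scheme.
               Module.module (prime_field p) W \<longrightarrow> natural_group (add_monoid W)))"
proof (intro conjI allI impI)
  fix K :: "('k, 'm) ring_scheme" assume "field K"
  thus "natural_group (add_monoid K)" by (rule natural_group_field)
next
  fix V :: "(rat, 'v, 'n) module_scheme" assume "module rat_field V"
  thus "natural_group (add_monoid V)"
    by (rule natural_group_vector_space[OF field_from_type_algebra]) simp
next
  fix p :: nat and W :: "(int, 'w, 'l) module_scheme"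
  assume "prime p" and W: "module (prime_field p) W"
  have "field (prime_field p)"
    using \<open>prime p\<close> by (intro residues_prime.is_field residues_prime.intro)
  thus "natural_group (add_monoid W)"
    using W by (rule natural_group_vector_space) simp
qed

end
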